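(* Let $n\ge 0$. Let $x_0<x_1<\dots<x_n$ be the roots of the Hermite polynomial $H_{n+1}$, and let $w_0,\dots,w_n$ be the weights of the corresponding $(n+1)$-point Gauss-Hermite quadrature rule with respect to the weight function $e^{-x^2}$ on $(-\infty,\infty)$. Then the barycentric weights $\lambda_j=\prod_{k\neq j}(x_j-x_k)^{-1}$ of the nodes $x_0,\dots,x_n$ are $$\lambda_j=C\,(-1)^j\sqrt{w_j},\qquad j=0,\dots,n,\qquad C=\sigma\sqrt{\frac{2^n}{(n+1)!\,\sqrt{\pi}}},$$ with $\sigma=+1$ for even $n$ and $\sigma=-1$ for odd $n$. In particular, simplified barycentric weights for these nodes are $(-1)^j\sqrt{w_j}$, $j=0,\dots,n$.
   Context: $H_m$ denotes the physicists' Hermite polynomial (leading coefficient $2^m$, $H_m''-2xH_m'+2mH_m=0$). The Gaussian quadrature rule $\int_{-\infty}^\infty e^{-x^2}f(x)\,dx\simeq\sum_{j=0}^nw_jf(x_j)$ is exact for all polynomials of degree at most $2n+1$. Simplified barycentric weights are any numbers obtained from the barycentric weights $\lambda_0,\dots,\lambda_n$ by dividing all of them by a common nonzero factor independent of $j$. *)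

theory Defs
  imports "HOL-Analysis.Analysis" "HOL-Computational_Algebra.Polynomial"
begin

definition is_hermite :: "nat \<Rightarrow> real poly \<Rightarrow> bool" where
  "is_hermite m p \<longleftrightarrow> degree p = m \<and> lead_coeff p = 2 ^ m \<and>
     pderiv (pderiv p) - [:0, 2:] * pderiv p + smult (2 * real m) p = 0"

text \<open>The description is well-posed by \<open>ex1_hermite\<close> below.\<close>

definition hermite :: "nat \<Rightarrow> real poly" where
  "hermite m = (THE p. is_hermite m p)"

lemma ex_hermite: "\<exists>p. is_hermite m p"
proof (induction m)
  case 0
  show ?case by (intro exI[of _ 1]) (simp add: is_hermite_def)
next
  case (Suc m)
  then obtain p where d: "degree p = m" and lc: "lead_coeff p = 2 ^ m"
    and ode: "pderiv (pderiv p) - [:0, 2:] * pderiv p + smult (2 * real m) p = 0"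
    by (auto simp: is_hermite_def)
  define q where "q = [:0, 2:] * p - pderiv p"
  have p0: "p \<noteq> 0" using lc by auto
  have c: "coeff q k = (if k = 0 then 0 else 2 * coeff p (k - 1)) - real (Suc k) * coeff p (Suc k)" for k
    by (cases k) (simp_all add: q_def coeff_pderiv)
  have "coeff q (Suc m) = 2 ^ Suc m"
    using lc d by (simp add: c coeff_eq_0)
  moreover have "degree q \<le> Suc m"
    by (rule degree_le) (use d in \<open>auto simp: c coeff_eq_0\<close>)
  ultimately have dq: "degree q = Suc m" "lead_coeff q = 2 ^ Suc m"
    by (metis le_antisym le_degree power_not_zero zero_neq_numeral)+
  have "pderiv q = [:2:] * p + [:0, 2:] * pderiv p - pderiv (pderiv p)"
    by (simp add: q_def pderiv_diff pderiv_mult pderiv_pCons pderiv_smult)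
  also have "\<dots> = [:2:] * p + smult (2 * real m) p"
    using ode by (simp add: algebra_simps eq_diff_eq)
  also have "\<dots> = smult (2 * real (Suc m)) p"
    by (simp add: algebra_simps flip: smult_add_left)
  finally have q': "pderiv q = smult (2 * real (Suc m)) p" .
  have "pderiv (pderiv q) - [:0, 2:] * pderiv q + smult (2 * real (Suc m)) q = 0"
    unfolding q' pderiv_smult by (simp add: q_def smult_diff_right)
  with dq show ?case unfolding is_hermite_def by blast
qed

lemma is_hermite_unique:
  assumes p: "is_hermite m p" and q: "is_hermite m q"
  shows "p = q"
proof (rule ccontr)
  assume "p \<noteq> q"
  define r where "r = p - q"
  have r0: "r \<noteq> 0" using \<open>p \<noteq> q\<close> by (simp add: r_def)
  have cm: "coeff r m = 0" and dle: "degree r \<le> m"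
    using p q degree_diff_le[of p m q] by (auto simp: is_hermite_def r_def)
  have "degree r \<noteq> m" using cm r0 by auto
  with dle have dlt: "degree r < m" by simp
  have "pderiv (pderiv r) - [:0, 2:] * pderiv r + smult (2 * real m) r
     = (pderiv (pderiv p) - [:0, 2:] * pderiv p + smult (2 * real m) p)
     - (pderiv (pderiv q) - [:0, 2:] * pderiv q + smult (2 * real m) q)"
    by (simp add: r_def pderiv_diff smult_diff_right algebra_simps)
  also have "\<dots> = 0" using p q by (simp add: is_hermite_def)
  finally have "coeff (pderiv (pderiv r) - [:0, 2:] * pderiv r + smult (2 * real m) r) (degree r) = 0"
    by simp
  moreover have "coeff (pderiv (pderiv r)) (degree r) = 0"
    by (simp add: coeff_pderiv coeff_eq_0)
  moreover have "coeff ([:0, 2:] * pderiv r) (degree r) = 2 * real (degree r) * lead_coeff r"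
    by (cases "degree r") (simp_all add: coeff_pderiv)
  ultimately have "2 * (real m - real (degree r)) * lead_coeff r = 0"
    by (simp add: algebra_simps)
  with r0 dlt show False by simp
qed

lemma ex1_hermite: "\<exists>!p. is_hermite m p"
  using ex_hermite is_hermite_unique by blast

lemma is_hermite_hermite: "is_hermite m (hermite m)"
  unfolding hermite_def by (rule theI'[OF ex1_hermite])

text \<open>All nodes and weights are indexed by \<open>0, \<dots>, n\<close>; values at indices above \<open>n\<close> are irrelevant.\<close>

definition gauss_hermite_nodes :: "nat \<Rightarrow> (nat \<Rightarrow> real) \<Rightarrow> bool" where
  "gauss_hermite_nodes n x \<longleftrightarrow>
     strict_mono_on {0..n} x \<and> x ` {0..n} = {t. poly (hermite (n + 1)) t = 0}"

definition gauss_hermite_weights :: "nat \<Rightarrow> (nat \<Rightarrow> real) \<Rightarrow> (nat \<Rightarrow> real) \<Rightarrow> bool" where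
  "gauss_hermite_weights n x w \<longleftrightarrow>
     (\<forall>p :: real poly. degree p \<le> 2 * n + 1 \<longrightarrow>
        (LBINT t. exp (- (t\<^sup>2)) * poly p t) = (\<Sum>j=0..n. w j * poly p (x j)))"

definition barycentric_weight :: "nat \<Rightarrow> (nat \<Rightarrow> real) \<Rightarrow> nat \<Rightarrow> real" where
  "barycentric_weight n x j = (\<Prod>k\<in>{0..n} - {j}. inverse (x j - x k))"

definition simplified_barycentric_weights :: "nat \<Rightarrow> (nat \<Rightarrow> real) \<Rightarrow> (nat \<Rightarrow> real) \<Rightarrow> bool" where
  "simplified_barycentric_weights n x \<mu> \<longleftrightarrow>
     (\<exists>c. c \<noteq> 0 \<and> (\<forall>j\<in>{0..n}. \<mu> j = barycentric_weight n x j / c))"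

end

theory Submission
  imports Defs "HOL-Probability.Distributions" "HOL-Real_Asymp.Real_Asymp"
begin

text \<open>
  Write \<open>N = n + 1\<close> and let \<open>P\<^sub>j\<close> be the product of the \<open>X - x\<^sub>k\<close> over \<open>k \<noteq> j\<close>, so that
  \<open>\<lambda>\<^sub>j = 1 / P\<^sub>j(x\<^sub>j)\<close>. The polynomial \<open>P\<^sub>j H\<^sub>n\<close> has degree \<open>2n\<close>, hence is integrated exactly, and
  its only nonzero value at a node is the one at \<open>x\<^sub>j\<close>. On the one hand, \<open>H\<^sub>N' = 2N H\<^sub>n\<close> and
  \<open>H\<^sub>N = 2\<^sup>N (X - x\<^sub>j) P\<^sub>j\<close> give \<open>H\<^sub>n(x\<^sub>j) = 2\<^sup>n P\<^sub>j(x\<^sub>j) / N\<close>; on the other hand, repeated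
  integration by parts gives the integral \<open>n! \<surd>\<pi>\<close>, as \<open>P\<^sub>j\<close> is monic. Comparing the two
  determines \<open>\<lambda>\<^sub>j\<^sup>2\<close>, and the sign of \<open>\<lambda>\<^sub>j\<close> is read off the ordering of the nodes.
\<close>

text \<open>The available Gaussian moments live on the positive half-line; reflection extends them
  to the whole line, evenly or oddly according to the parity of \<open>k\<close>.\<close>

lemma integrable_gaussian_power: "integrable lborel (\<lambda>t::real. exp (- t\<^sup>2) * t ^ k)"
proof (cases "even k")
  case True
  then obtain m where "k = 2 * m" by blast
  then show ?thesis
    using has_bochner_integral_even_function[OF gaussian_moment_even_pos[of m]]
    by (auto simp: has_bochner_integral_iff)
next
  case False
  then obtain m where "k = 2 * m + 1" by (elim oddE)
  then show ?thesis
    using has_bochner_integral_odd_function[OF gaussian_moment_odd_pos[of m]]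
    by (auto simp: has_bochner_integral_iff)
qed

lemma integrable_gaussian_poly: "integrable lborel (\<lambda>t. exp (- t\<^sup>2) * poly p t :: real)"
proof -
  have "integrable lborel (\<lambda>t. \<Sum>i\<le>degree p. coeff p i * (exp (- t\<^sup>2) * t ^ i))"
    by (intro Bochner_Integration.integrable_sum integrable_mult_right integrable_gaussian_power)
  then show ?thesis
    by (simp add: poly_altdef sum_distrib_left mult_ac)
qed

lemma tendsto_gaussian_poly_at_top: "((\<lambda>t::real. exp (- t\<^sup>2) * poly p t) \<longlongrightarrow> 0) at_top"
proof -
  have "((\<lambda>t::real. exp (- t\<^sup>2) * t ^ k) \<longlongrightarrow> 0) at_top" for k
    by real_asymp
  then have "((\<lambda>t::real. \<Sum>i\<le>degree p. coeff p i * (exp (- t\<^sup>2) * t ^ i)) \<longlongrightarrow> 0) at_top"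
    by (intro tendsto_null_sum tendsto_mult_right_zero)
  then show ?thesis
    by (simp add: poly_altdef sum_distrib_left mult_ac)
qed

lemma tendsto_gaussian_poly_at_bot: "((\<lambda>t::real. exp (- t\<^sup>2) * poly p t) \<longlongrightarrow> 0) at_bot"
  using tendsto_gaussian_poly_at_top[of "pcompose p [:0, -1:]"]
  by (simp add: filterlim_at_bot_mirror poly_pcompose)

text \<open>The integrand is the derivative of \<open>exp (- t\<^sup>2) * poly p t\<close>, which
  tends to 0 at both ends. Each integration by parts below is an instance of this.\<close>

lemma integral_gaussian_poly_derivative:
  "(LBINT t. exp (- t\<^sup>2) * poly (pderiv p - [:0, 2:] * p) t) = (0::real)"
proof -
  let ?f = "\<lambda>t. exp (- t\<^sup>2) * poly (pderiv p - [:0, 2:] * p) t"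
  have "(LBINT t=-\<infinity>..\<infinity>. ?f t) = 0 - 0"
  proof (rule interval_integral_FTC_integrable)
    show "((\<lambda>t. exp (- t\<^sup>2) * poly p t) has_vector_derivative ?f t) (at t)" for t
      unfolding has_real_derivative_iff_has_vector_derivative[symmetric]
      by (auto intro!: derivative_eq_intros poly_DERIV simp: algebra_simps)
    show "set_integrable lborel (einterval (-\<infinity>) \<infinity>) ?f"
      using integrable_gaussian_poly[of "pderiv p - [:0, 2:] * p"]
      by (simp add: set_integrable_def)
  qed (auto intro!: continuous_intros tendsto_gaussian_poly_at_top tendsto_gaussian_poly_at_bot
        simp: ereal_tendsto_simps)
  then show ?thesis
    by (simp add: interval_lebesgue_integral_def set_lebesgue_integral_def)
qed

lemma hermite_0: "hermite 0 = 1"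
  by (rule is_hermite_unique[OF is_hermite_hermite]) (simp add: is_hermite_def)

lemma degree_hermite: "degree (hermite m) = m"
  using is_hermite_hermite[of m] by (simp add: is_hermite_def)

lemma lead_coeff_hermite: "lead_coeff (hermite m) = 2 ^ m"
  using is_hermite_hermite[of m] unfolding is_hermite_def by blast

lemma hermite_ode:
  "pderiv (pderiv (hermite m)) = [:0, 2:] * pderiv (hermite m) - smult (2 * real m) (hermite m)"
  using is_hermite_hermite[of m] by (simp add: is_hermite_def algebra_simps eq_diff_eq)

text \<open>Differentiating the equation of index \<open>Suc m\<close> shows that the rescaled
  derivative \<open>q\<close> solves the one of index \<open>m\<close>; its leading coefficient is
  right as well, so uniqueness applies.\<close>

lemma pderiv_hermite_Suc: "pderiv (hermite (Suc m)) = smult (2 * real (Suc m)) (hermite m)"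
proof -
  let ?H = "hermite (Suc m)" and ?c = "2 * real (Suc m)"
  define q where "q = smult (inverse ?c) (pderiv ?H)"
  have H': "pderiv ?H = smult ?c q"
    by (simp add: q_def)
  have deg: "degree q = m"
    by (simp add: q_def degree_pderiv degree_hermite)
  have "lead_coeff q = 2 ^ m"
    using lead_coeff_hermite[of "Suc m"]
    by (simp add: q_def degree_pderiv degree_hermite coeff_pderiv field_simps)
  moreover have "pderiv (pderiv q) - [:0, 2:] * pderiv q + smult (2 * real m) q = 0"
  proof -
    have "pderiv (pderiv (pderiv ?H))
        = [:2:] * pderiv ?H + [:0, 2:] * pderiv (pderiv ?H) - smult ?c (pderiv ?H)"
      by (subst hermite_ode) (simp add: pderiv_diff pderiv_mult pderiv_smult pderiv_pCons)
    then have "smult ?c (pderiv (pderiv q))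
        = [:2:] * smult ?c q + [:0, 2:] * smult ?c (pderiv q) - smult ?c (smult ?c q)"
      by (simp only: H' pderiv_smult)
    \<comment> \<open>Evaluation turns the identity into real algebra. The term
      \<open>2 * q\<close>, which comes from differentiating the factor \<open>[:0, 2:]\<close>,
      lowers the eigenvalue from \<open>2 * Suc m\<close> to \<open>2 * m\<close>.\<close>
    then have "poly (smult ?c (pderiv (pderiv q))) t
        = poly ([:2:] * smult ?c q + [:0, 2:] * smult ?c (pderiv q) - smult ?c (smult ?c q)) t" for t
      by simp
    then have "?c * (poly (pderiv (pderiv q)) t
        - 2 * t * poly (pderiv q) t + 2 * real m * poly q t) = 0" for t
      by (simp add: algebra_simps)
    then show ?thesis
      by (subst poly_eq_poly_eq_iff[symmetric]) (auto simp: fun_eq_iff mult_ac)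
  qed
  ultimately have "is_hermite m q"
    using deg by (simp add: is_hermite_def)
  then have "q = hermite m"
    by (rule is_hermite_unique[OF _ is_hermite_hermite])
  with H' show ?thesis by simp
qed

text \<open>Substitute the derivative formula into the differential equation of index
  \<open>Suc m\<close> and cancel \<open>2 * Suc m\<close>.\<close>

lemma hermite_Suc: "hermite (Suc m) = [:0, 2:] * hermite m - pderiv (hermite m)"
proof -
  let ?c = "2 * real (Suc m)"
  have "smult ?c (hermite (Suc m)) = smult ?c ([:0, 2:] * hermite m - pderiv (hermite m))"
    using hermite_ode[of "Suc m"]
    by (simp add: pderiv_hermite_Suc pderiv_smult smult_diff_right algebra_simps
             del: of_nat_Suc mult_pCons_left)
  then show ?thesis by (simp del: of_nat_Suc mult_pCons_left add: smult_eq_iff)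
qed

text \<open>The recurrence and integration by parts trade \<open>q * hermite (Suc m)\<close> for
  \<open>pderiv q * hermite m\<close>, and the coefficients of \<open>pderiv q\<close> build up the
  factorial. Using \<open>coeff q m\<close> instead of the leading coefficient also covers smaller
  degrees, where the integral is 0.\<close>

lemma integral_gaussian_hermite:
  assumes "degree q \<le> m"
  shows "(LBINT t. exp (- t\<^sup>2) * poly (q * hermite m) t) = fact m * coeff q m * sqrt pi"
  using assms
proof (induction m arbitrary: q)
  case 0
  then obtain c where "q = [:c:]" by (auto elim: degree_eq_zeroE)
  moreover have "has_bochner_integral lborel (\<lambda>t::real. exp (- t\<^sup>2)) (sqrt pi)"
    using has_bochner_integral_even_function[OF gaussian_moment_0] by simp
  ultimately show ?case
    by (simp add: hermite_0 has_bochner_integral_iff)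
next
  case (Suc m)
  have "q * hermite (Suc m)
      = pderiv q * hermite m - (pderiv (q * hermite m) - [:0, 2:] * (q * hermite m))"
    by (simp add: hermite_Suc pderiv_mult algebra_simps)
  then have "(LBINT t. exp (- t\<^sup>2) * poly (q * hermite (Suc m)) t)
      = (LBINT t. exp (- t\<^sup>2) * poly (pderiv q * hermite m) t
          - exp (- t\<^sup>2) * poly (pderiv (q * hermite m) - [:0, 2:] * (q * hermite m)) t)"
    by (simp only: poly_diff right_diff_distrib)
  also have "\<dots> = (LBINT t. exp (- t\<^sup>2) * poly (pderiv q * hermite m) t)"
    by (subst Bochner_Integration.integral_diff)
       (simp_all only: integrable_gaussian_poly integral_gaussian_poly_derivative diff_zero)
  also have "\<dots> = fact m * coeff (pderiv q) m * sqrt pi"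
    using Suc.prems by (intro Suc.IH) (simp add: degree_pderiv)
  finally show ?case by (simp add: coeff_pderiv)
qed

text \<open>The factor of index \<open>k\<close> is negative exactly for \<open>k > j\<close>. There
  are \<open>n - j\<close> such indices, a number of the same parity as
  \<open>n + j\<close>.\<close>

lemma barycentric_weight_eq_abs:
  assumes "strict_mono_on {0..n} x" and "j \<le> n"
  shows "barycentric_weight n x j = (- 1) ^ (n + j) * \<bar>barycentric_weight n x j\<bar>"
proof -
  let ?I = "{0..n} - {j}"
  have "barycentric_weight n x j
      = (\<Prod>k\<in>?I. (if j < k then - 1 else 1) * \<bar>inverse (x j - x k)\<bar>)"
    unfolding barycentric_weight_def
  proof (rule prod.cong)
    fix k assume k: "k \<in> ?I"
    show "inverse (x j - x k) = (if j < k then - 1 else 1) * \<bar>inverse (x j - x k)\<bar>"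
    proof (cases "j < k")
      case True
      then have "x j < x k" using k by (intro strict_mono_onD[OF assms(1)]) auto
      with True show ?thesis by (simp add: abs_if)
    next
      case False
      then have "x k < x j" using k assms(2) by (intro strict_mono_onD[OF assms(1)]) auto
      with False show ?thesis by simp
    qed
  qed simp
  also have "\<dots> = (- 1) ^ card (?I \<inter> {k. j < k}) * \<bar>barycentric_weight n x j\<bar>"
    by (simp add: prod.distrib prod.If_cases barycentric_weight_def abs_prod)
  also have "?I \<inter> {k. j < k} = {j<..n}" by auto
  also have "(- 1) ^ card {j<..n} = (- 1 :: real) ^ (n + j)"
    using assms(2) by (simp add: uminus_power_if)
  finally show ?thesis .
qed

lemma gauss_hermite_barycentric_weight_square:
  assumes nodes: "gauss_hermite_nodes n x" and weights: "gauss_hermite_weights n x w"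
    and j: "j \<le> n"
  shows "(barycentric_weight n x j)\<^sup>2 = 2 ^ n / (fact (n + 1) * sqrt pi) * w j"
proof -
  let ?I = "{0..n} - {j}"
  define P where "P = (\<Prod>k\<in>?I. [:- x k, 1:])"
  have mono: "strict_mono_on {0..n} x" and roots: "x ` {0..n} = {t. poly (hermite (Suc n)) t = 0}"
    using nodes by (auto simp: gauss_hermite_nodes_def)
  have inj: "inj_on x {0..n}"
    using mono by (rule strict_mono_on_imp_inj_on)
  have degP: "degree P = n"
    using j by (simp add: P_def degree_prod_sum_eq)
  have lcP: "lead_coeff P = 1"
    unfolding P_def lead_coeff_prod by simp
  have nz: "poly P (x j) \<noteq> 0"
    using inj j by (auto simp: P_def poly_prod inj_on_def)
  have bary: "barycentric_weight n x j = inverse (poly P (x j))"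
    by (simp add: barycentric_weight_def P_def poly_prod prod_inversef[symmetric] o_def)
  have P0: "poly P (x k) = 0" if "k \<in> ?I" for k
    using that by (auto simp: P_def poly_prod)
  \<comment> \<open>Both sides have degree at most \<open>Suc n\<close> and the same coefficient
    there, so their difference has degree at most \<open>n\<close>; it vanishes at
    \<open>n + 1\<close> distinct nodes.\<close>
  have H: "hermite (Suc n) = smult (2 ^ Suc n) ([:- x j, 1:] * P)"
  proof (rule poly_eqI_degree_lead_coeff)
    show "coeff (hermite (Suc n)) (Suc n) = coeff (smult (2 ^ Suc n) ([:- x j, 1:] * P)) (Suc n)"
      using lead_coeff_hermite[of "Suc n"] degP lcP by (simp add: degree_hermite coeff_eq_0)
    show "card (x ` {0..n}) \<ge> Suc n"
      using inj by (simp add: card_image)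
    show "poly (hermite (Suc n)) t = poly (smult (2 ^ Suc n) ([:- x j, 1:] * P)) t"
      if "t \<in> x ` {0..n}" for t
      using that roots P0 by force
  qed (use degP degree_mult_le[of "[:- x j, 1:]" P] in \<open>simp_all add: degree_hermite\<close>)
  \<comment> \<open>In the product rule, the term with \<open>pderiv P\<close> keeps the factor that
    vanishes at \<open>x j\<close>.\<close>
  have "poly (pderiv (hermite (Suc n))) (x j) = 2 ^ Suc n * poly P (x j)"
    by (subst H) (simp add: pderiv_smult pderiv_mult pderiv_pCons del: mult_pCons_left)
  then have Hn: "real (Suc n) * poly (hermite n) (x j) = 2 ^ n * poly P (x j)"
    by (simp add: pderiv_hermite_Suc algebra_simps)
  have "degree (P * hermite n) \<le> 2 * n + 1"
    using degree_mult_le[of P "hermite n"] by (simp add: degP degree_hermite)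
  then have "(LBINT t. exp (- (t\<^sup>2)) * poly (P * hermite n) t)
      = (\<Sum>k=0..n. w k * poly (P * hermite n) (x k))"
    using weights by (simp only: gauss_hermite_weights_def)
  also have "\<dots> = (\<Sum>k\<in>{j}. w k * poly (P * hermite n) (x k))"
    using j P0 by (intro sum.mono_neutral_right) auto
  finally have "fact n * sqrt pi = w j * (poly P (x j) * poly (hermite n) (x j))"
    using integral_gaussian_hermite[of P n] degP lcP by simp
  then have "real (Suc n) * (fact n * sqrt pi)
      = w j * poly P (x j) * (real (Suc n) * poly (hermite n) (x j))"
    by (simp add: mult_ac)
  then have eq: "fact (n + 1) * sqrt pi = 2 ^ n * w j * (poly P (x j))\<^sup>2"
    unfolding Hn by (simp add: power2_eq_square mult_ac)
  have "inverse (poly P (x j)) ^ 2 * (fact (n + 1) * sqrt pi) = 2 ^ n * w j"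
    unfolding eq using nz by (simp add: power_inverse)
  then show ?thesis
    unfolding bary times_divide_eq_left by (subst nonzero_eq_divide_eq) simp_all
qed

theorem corollary5:
  fixes n :: nat and x w :: "nat \<Rightarrow> real" and \<sigma> C :: real
  assumes nodes: "gauss_hermite_nodes n x"
    and weights: "gauss_hermite_weights n x w"
    and sigma: "\<sigma> = (if even n then 1 else - 1)"
    and C: "C = \<sigma> * sqrt (2 ^ n / (fact (n + 1) * sqrt pi))"
  shows "(\<forall>j\<in>{0..n}. barycentric_weight n x j = C * (- 1) ^ j * sqrt (w j)) \<and>
         simplified_barycentric_weights n x (\<lambda>j. (- 1) ^ j * sqrt (w j))"
proof -
  have bary: "barycentric_weight n x j = C * (- 1) ^ j * sqrt (w j)" if "j \<in> {0..n}" for j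
  proof -
    have j: "j \<le> n" using that by simp
    \<comment> \<open>Here \<open>sqrt\<close> is odd and multiplicative on all reals, so the root
      of the product splits before the sign of \<open>w j\<close> is known.\<close>
    have "\<bar>barycentric_weight n x j\<bar> = sqrt (2 ^ n / (fact (n + 1) * sqrt pi)) * sqrt (w j)"
      using gauss_hermite_barycentric_weight_square[OF nodes weights j]
      by (metis real_sqrt_abs real_sqrt_mult)
    moreover have "strict_mono_on {0..n} x"
      using nodes by (simp add: gauss_hermite_nodes_def)
    moreover have "\<sigma> = (- 1) ^ n"
      by (simp add: sigma uminus_power_if)
    \<comment> \<open>The sign \<open>(- 1) ^ (n + j)\<close> splits into \<open>\<sigma>\<close>
      and \<open>(- 1) ^ j\<close>.\<close>
    ultimately show ?thesis
      using barycentric_weight_eq_abs[OF _ j, of x] by (simp add: C power_add)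
  qed
  moreover have "C \<noteq> 0"
    by (simp add: C sigma)
  ultimately show ?thesis
    unfolding simplified_barycentric_weights_def by auto
qed

end
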